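(* Let $P$ be a finite poset. For $n\ge 1$ let $M_1(P,n)$ (respectively $M_2(P,n)$) denote the largest $M$ such that there are embeddings (respectively induced embeddings) $f_1,\dots,f_M:P\to B_n$ such that $\{\mathrm{Im}(f_i): i=1,\dots,M\}$ is an incomparable family. Then \[ \lim_{n\to\infty}\frac{M_1(P,n)}{\binom{n}{\lfloor n/2\rfloor}}=\frac{1}{t_1(P)},\qquad \lim_{n\to\infty}\frac{M_2(P,n)}{\binom{n}{\lfloor n/2\rfloor}}=\frac{1}{t_2(P)}. \]
   Context: $B_n$ denotes the Boolean lattice: the poset of all subsets of $[n]=\{1,\dots,n\}$ ordered by inclusion. For a finite poset $(P,<_p)$, an embedding $f:P\to B_n$ is an injective map with $f(a)\subset f(b)$ whenever $a<_p b$; it is an induced embedding if it is injective and $f(a)\subset f(b)$ holds if and only if $a<_p b$. Two sets $X,Y$ of subsets of $[n]$ are incomparable if there are no $x\in X$, $y\in Y$ with $x\subseteq y$ or $y\subseteq x$; a family of sets of subsets is incomparable if its members are pairwise incomparable. For $F\subseteq B_n$, the convex hull is $\mathrm{conv}(F)=\{b\in B_n:\exists a,c\in F,\ a\subseteq b\subseteq c\}$. Define $t_1(P)=\min\{|\mathrm{conv}(\mathrm{Im}(f))|: n\ge 1,\ f:P\to B_n \text{ an embedding}\}$ and $t_2(P)=\min\{|\mathrm{conv}(\mathrm{Im}(f))|: n\ge 1,\ f:P\to B_n \text{ an induced embedding}\}$. *)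

theory Defs
  imports Complex_Main
begin

text \<open>A finite poset is given by a carrier \<open>P\<close> and its strict order \<open>lt\<close>; the Boolean lattice
  \<open>B\<^sub>n\<close> is \<open>Pow {1..n}\<close> ordered by inclusion.\<close>

definition finite_poset :: "'a set \<Rightarrow> ('a \<Rightarrow> 'a \<Rightarrow> bool) \<Rightarrow> bool" where
  "finite_poset P lt \<longleftrightarrow> finite P \<and> irreflp_on P lt \<and> transp_on P lt"

definition boolean_lattice :: "nat \<Rightarrow> nat set set" where
  "boolean_lattice n = Pow {1..n}"

definition embedding ::
  "'a set \<Rightarrow> ('a \<Rightarrow> 'a \<Rightarrow> bool) \<Rightarrow> nat \<Rightarrow> ('a \<Rightarrow> nat set) \<Rightarrow> bool" where
  "embedding P lt n f \<longleftrightarrow>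
     f ` P \<subseteq> boolean_lattice n \<and> inj_on f P \<and>
     (\<forall>a\<in>P. \<forall>b\<in>P. lt a b \<longrightarrow> f a \<subset> f b)"

definition induced_embedding ::
  "'a set \<Rightarrow> ('a \<Rightarrow> 'a \<Rightarrow> bool) \<Rightarrow> nat \<Rightarrow> ('a \<Rightarrow> nat set) \<Rightarrow> bool" where
  "induced_embedding P lt n f \<longleftrightarrow>
     f ` P \<subseteq> boolean_lattice n \<and> inj_on f P \<and>
     (\<forall>a\<in>P. \<forall>b\<in>P. f a \<subset> f b \<longleftrightarrow> lt a b)"

definition incomparable :: "nat set set \<Rightarrow> nat set set \<Rightarrow> bool" where
  "incomparable X Y \<longleftrightarrow> \<not> (\<exists>x\<in>X. \<exists>y\<in>Y. x \<subseteq> y \<or> y \<subseteq> x)"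

definition conv :: "nat \<Rightarrow> nat set set \<Rightarrow> nat set set" where
  "conv n F = {b \<in> boolean_lattice n. \<exists>a\<in>F. \<exists>c\<in>F. a \<subseteq> b \<and> b \<subseteq> c}"

definition t1 :: "'a set \<Rightarrow> ('a \<Rightarrow> 'a \<Rightarrow> bool) \<Rightarrow> nat" where
  "t1 P lt = (LEAST k. \<exists>n\<ge>1. \<exists>f. embedding P lt n f \<and> k = card (conv n (f ` P)))"

definition t2 :: "'a set \<Rightarrow> ('a \<Rightarrow> 'a \<Rightarrow> bool) \<Rightarrow> nat" where
  "t2 P lt = (LEAST k. \<exists>n\<ge>1. \<exists>f. induced_embedding P lt n f \<and> k = card (conv n (f ` P)))"

text \<open>Incomparability is required of the images as an indexed family: distinct indices give
  incomparable, hence (for nonempty \<open>P\<close>) distinct, images. Repeated embeddings would otherwise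
  make the number of copies unbounded.\<close>

definition M1 :: "'a set \<Rightarrow> ('a \<Rightarrow> 'a \<Rightarrow> bool) \<Rightarrow> nat \<Rightarrow> nat" where
  "M1 P lt n = (GREATEST M. \<exists>f :: nat \<Rightarrow> 'a \<Rightarrow> nat set.
     (\<forall>i\<in>{1..M}. embedding P lt n (f i)) \<and>
     pairwise (\<lambda>i j. incomparable (f i ` P) (f j ` P)) {1..M})"

definition M2 :: "'a set \<Rightarrow> ('a \<Rightarrow> 'a \<Rightarrow> bool) \<Rightarrow> nat \<Rightarrow> nat" where
  "M2 P lt n = (GREATEST M. \<exists>f :: nat \<Rightarrow> 'a \<Rightarrow> nat set.
     (\<forall>i\<in>{1..M}. induced_embedding P lt n (f i)) \<and>
     pairwise (\<lambda>i j. incomparable (f i ` P) (f j ` P)) {1..M})"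

end

theory Submission
  imports Defs "HOL-Combinatorics.Multiset_Permutations" "HOL-Real_Asymp.Real_Asymp"
begin

text \<open>Upper bound: incomparable copies have pairwise incomparable convex hulls, so every maximal
  chain meets at most one hull. A hull has at least \<open>t\<close> elements (\<open>t\<close> is \<open>t1\<close> or \<open>t2\<close>), each on a fraction
  \<open>1 / (n choose card x)\<close> of the chains. If one element is within \<open>K\<close> of the bottom or the top, it
  alone lies on enough chains; otherwise a chain through \<open>x\<close> passes through a given larger element
  with probability at most \<open>1 / K\<close>, so \<open>t\<close> elements meet a fraction of about
  \<open>t / (n choose (n div 2))\<close> of the chains.

  Lower bound: let \<open>H\<close> be an optimal hull in \<open>B\<^sub>m\<close>. Write \<open>B\<^sub>N\<close> with \<open>N = q m\<close> as a product of
  \<open>q\<close> blocks \<open>B\<^sub>m\<close> and put a point into a translate of \<open>H\<close> in the first direction whose coordinate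
  lies in \<open>H\<close>. This covers all but a fraction \<open>(1 - t / 2^m)^q\<close> of \<open>B\<^sub>N\<close> by translates, and because
  \<open>H\<close> is convex they carry a rank that increases strictly between comparable points of different
  translates. Extending the translates of rank \<open>c\<close> by all sets of size \<open>n div 2 - c\<close> in the remaining
  \<open>n - N\<close> elements gives incomparable copies, about \<open>(n choose (n div 2)) / 2^N\<close> for each
  translate.\<close>

section \<open>Maximal chains of the Boolean lattice\<close>

text \<open>A maximal chain of \<open>Pow A\<close> is encoded by the permutation of \<open>A\<close> whose initial segments
  are its members.\<close>

definition chains_through :: "'b set \<Rightarrow> 'b set \<Rightarrow> 'b list set" where
  "chains_through A x = {xs \<in> permutations_of_set A. set (take (card x) xs) = x}"

lemma chains_through_subset: "chains_through A x \<subseteq> permutations_of_set A"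
  by (auto simp: chains_through_def)

lemma finite_chains_through: "finite (chains_through A x)"
  by (simp add: chains_through_def)

text \<open>Initial segments of one list are nested.\<close>

lemma chains_through_comparable:
  assumes "xs \<in> chains_through A x" "xs \<in> chains_through A y"
  shows "x \<subseteq> y \<or> y \<subseteq> x"
  using assms set_take_subset_set_take[of "card x" "card y" xs]
    set_take_subset_set_take[of "card y" "card x" xs] nat_le_linear[of "card x" "card y"]
  unfolding chains_through_def by blast

text \<open>Cutting a list after \<open>card x\<close> entries matches these chains with pairs of an
  ordering of \<open>x\<close> and an ordering of its complement.\<close>

lemma card_chains_through:
  assumes "finite A" "x \<subseteq> A"
  shows "card (chains_through A x) = fact (card x) * fact (card A - card x)"
proof -
  let ?f = "\<lambda>(ys, zs). ys @ zs"
  have fin: "finite x" using assms finite_subset by blast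
  have "bij_betw ?f (permutations_of_set x \<times> permutations_of_set (A - x)) (chains_through A x)"
    unfolding bij_betw_def
  proof
    show "inj_on ?f (permutations_of_set x \<times> permutations_of_set (A - x))"
    proof (rule inj_onI, clarify)
      fix a b a' b' assume h: "a \<in> permutations_of_set x" "a' \<in> permutations_of_set x"
        and "a @ b = a' @ b'"
      moreover have "length a = length a'"
        using h by (simp add: length_finite_permutations_of_set)
      ultimately show "a = a' \<and> b = b'" by simp
    qed
    show "?f ` (permutations_of_set x \<times> permutations_of_set (A - x)) = chains_through A x"
    proof (intro equalityI subsetI)
      fix xs assume "xs \<in> ?f ` (permutations_of_set x \<times> permutations_of_set (A - x))"
      then obtain ys zs where h: "ys \<in> permutations_of_set x" "zs \<in> permutations_of_set (A - x)"
        and xs: "xs = ys @ zs" by auto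
      have "length ys = card x" using h(1) length_finite_permutations_of_set by blast
      then show "xs \<in> chains_through A x"
        using h assms xs by (auto simp: chains_through_def permutations_of_set_def)
    next
      fix xs assume h: "xs \<in> chains_through A x"
      have xs: "distinct xs" "set xs = A" "set (take (card x) xs) = x"
        using h by (auto simp: chains_through_def permutations_of_set_def)
      have u: "set (take (card x) xs) \<union> set (drop (card x) xs) = A"
        using xs(2) by (metis append_take_drop_id set_append)
      have d: "set (take (card x) xs) \<inter> set (drop (card x) xs) = {}"
        using xs(1) by (simp add: set_take_disj_set_drop_if_distinct)
      have "set (drop (card x) xs) = A - x" using u d xs(3) by blast
      then have "(take (card x) xs, drop (card x) xs) \<in> permutations_of_set x \<times> permutations_of_set (A - x)"
        using xs by (simp add: permutations_of_set_def)
      then show "xs \<in> ?f ` (permutations_of_set x \<times> permutations_of_set (A - x))"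
        by (metis (no_types, lifting) append_take_drop_id case_prod_conv image_eqI)
    qed
  qed
  then have "card (chains_through A x) = card (permutations_of_set x \<times> permutations_of_set (A - x))"
    by (simp add: bij_betw_same_card)
  then show ?thesis
    using assms fin by (simp add: card_cartesian_product card_Diff_subset)
qed

text \<open>Cutting at both \<open>card x\<close> and \<open>card y\<close> writes each common chain
  as a concatenation of orderings of \<open>x\<close>, \<open>y - x\<close> and
  \<open>A - y\<close>; for an upper bound it suffices that these concatenations cover.\<close>

lemma card_chains_through_two:
  assumes "finite A" "y \<subseteq> A" "x \<subset> y"
  shows "card (chains_through A x \<inter> chains_through A y)
         \<le> fact (card x) * fact (card y - card x) * fact (card A - card y)"
proof -
  let ?S = "permutations_of_set x \<times> permutations_of_set (y - x) \<times> permutations_of_set (A - y)"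
  have "finite y" using assms finite_subset by metis
  moreover then have "finite x" using assms finite_subset psubset_imp_subset by metis
  ultimately have fin: "finite y" "finite x" by simp_all
  have le: "card x \<le> card y" using assms fin by (simp add: card_mono)
  have "chains_through A x \<inter> chains_through A y \<subseteq> (\<lambda>(a, b, c). a @ b @ c) ` ?S"
  proof
    fix xs assume "xs \<in> chains_through A x \<inter> chains_through A y"
    then have xs: "distinct xs" "set xs = A" "set (take (card x) xs) = x" "set (take (card y) xs) = y"
      by (auto simp: chains_through_def permutations_of_set_def)
    define b where "b = drop (card x) (take (card y) xs)"
    have tk: "take (card y) xs = take (card x) xs @ b"
      using le by (metis b_def append_take_drop_id min.absorb1 take_take)
    have xsd: "xs = take (card x) xs @ b @ drop (card y) xs"
      using tk by (metis append.assoc append_take_drop_id)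
    have dd: "distinct (take (card x) xs @ b @ drop (card y) xs)" using xs(1) xsd by metis
    have "y = x \<union> set b" using tk xs(3,4) by (metis set_append)
    moreover have "x \<inter> set b = {}" using dd xs(3) by auto
    ultimately have sb: "set b = y - x" by blast
    have "A = x \<union> set b \<union> set (drop (card y) xs)" using xs(2,3) xsd by (metis set_append Un_assoc)
    moreover have "x \<inter> set (drop (card y) xs) = {}" "set b \<inter> set (drop (card y) xs) = {}"
      using dd xs(3) by auto
    ultimately have sc: "set (drop (card y) xs) = A - y" using sb assms by blast
    have "(take (card x) xs, b, drop (card y) xs) \<in> ?S"
      using dd xs(3) sb sc by (simp add: permutations_of_set_def)
    then show "xs \<in> (\<lambda>(a, b, c). a @ b @ c) ` ?S" using xsd by (force intro: image_eqI)
  qed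
  then have "card (chains_through A x \<inter> chains_through A y) \<le> card ?S"
    by (intro surj_card_le) auto
  also have "\<dots> = fact (card x) * fact (card y - card x) * fact (card A - card y)"
    using assms fin by (simp add: card_cartesian_product card_Diff_subset psubset_imp_subset finite_subset)
  finally show ?thesis .
qed

lemma choose_ge_self:
  assumes "1 \<le> b" "b < (a::nat)"
  shows "a \<le> a choose b"
  using assms
proof (induction a arbitrary: b)
  case (Suc a)
  show ?case
  proof (cases "b = a")
    case True then show ?thesis by simp
  next
    case False
    then have "a \<le> a choose b" using Suc by simp
    moreover have "a choose (b - 1) \<ge> 1" using Suc.prems by (simp add: Suc_le_eq)
    moreover have "Suc a choose b = (a choose (b - 1)) + (a choose b)"
      using Suc.prems by (metis Suc_diff_1 binomial_Suc_Suc less_eq_Suc_le One_nat_def)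
    ultimately show ?thesis by linarith
  qed
qed simp

text \<open>With \<open>a = card A - card x\<close> and \<open>b = card y - card x\<close>, at most
  one in \<open>a choose b\<close> of the chains through \<open>x\<close> passes through
  \<open>y\<close>. Since \<open>y\<close> lies strictly between \<open>x\<close> and
  \<open>A\<close>, we have \<open>1 <= b < a\<close>, hence \<open>a choose b >= a\<close>.\<close>

lemma card_chains_through_two_le:
  assumes "finite A" "y \<subset> A" "x \<subset> y"
  shows "(card A - card x) * card (chains_through A x \<inter> chains_through A y) \<le> card (chains_through A x)"
proof -
  have fin: "finite y" using assms finite_subset psubset_imp_subset by metis
  have c: "card x < card y" "card y < card A" using assms fin by (simp_all add: psubset_card_mono)
  let ?a = "card A - card x" and ?b = "card y - card x"
  have "?a * (fact (card x) * fact ?b * fact (card A - card y))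
      \<le> (?a choose ?b) * (fact (card x) * fact ?b * fact (card A - card y))"
    using c by (intro mult_right_mono choose_ge_self) auto
  also have "\<dots> = fact (card x) * (fact ?b * fact (?a - ?b) * (?a choose ?b))"
    using c by simp
  also have "\<dots> = fact (card x) * fact ?a"
    using c by (subst binomial_fact_lemma) auto
  also have "\<dots> = card (chains_through A x)"
    using assms by (subst card_chains_through) auto
  finally have "?a * (fact (card x) * fact ?b * fact (card A - card y)) \<le> card (chains_through A x)" .
  moreover have "?a * card (chains_through A x \<inter> chains_through A y)
     \<le> ?a * (fact (card x) * fact ?b * fact (card A - card y))"
    using assms by (intro mult_left_mono card_chains_through_two) auto
  ultimately show ?thesis by (rule order_trans[rotated])
qed

lemma card_chains_through_real:
  assumes "x \<subseteq> {1..n::nat}"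
  shows "real (card (chains_through {1..n} x)) = fact n / real (n choose card x)"
proof -
  have "card x \<le> n" using card_mono[OF _ assms] by simp
  then show ?thesis
    using assms by (simp add: card_chains_through binomial_fact field_simps)
qed

text \<open>Each member of \<open>S\<close> keeps the chains of which it is the largest member in \<open>S\<close>.\<close>

lemma card_chains_meeting_ge:
  assumes S: "S \<subseteq> Pow {1..n::nat}" and K: "K > 0"
    and size: "\<And>x. x \<in> S \<Longrightarrow> card x + K \<le> n"
  shows "real (card (\<Union>x\<in>S. chains_through {1..n} x))
         \<ge> real (card S) * (fact n / real (n choose (n div 2))) * (1 - real (card S) / real K)"
\<comment> \<open>For \<open>card S > K\<close> the right-hand side is at most 0. Otherwise its last
  factor is nonnegative, so the number of chains through each \<open>x\<close> may be replaced by
  its minimum, attained on the middle level.\<close>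
proof (cases "card S \<le> K")
  case True
  let ?A = "{1..n}"
  define U where "U x = (\<Union>y\<in>{y\<in>S. x \<subset> y}. chains_through ?A y)" for x
  define D where "D x = chains_through ?A x - U x" for x
  have finS: "finite S" using S finite_subset by blast
  have D_disj: "disjoint_family_on D S"
    unfolding disjoint_family_on_def
  proof (intro ballI impI)
    fix x y assume h: "x \<in> S" "y \<in> S" "x \<noteq> y"
    show "D x \<inter> D y = {}"
    proof (rule ccontr)
      assume "D x \<inter> D y \<noteq> {}"
      then obtain xs where xs: "xs \<in> D x" "xs \<in> D y" by blast
      then have "x \<subseteq> y \<or> y \<subseteq> x"
        unfolding D_def using chains_through_comparable by blast
      then show False using xs h unfolding D_def U_def by blast
    qed
  qed
  \<comment> \<open>Union bound: a chain through \<open>x\<close> is lost only if it meets a larger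
    member of \<open>S\<close>, and each such member takes at most a fraction
    \<open>1 / K\<close>.\<close>
  have D_ge: "real (card (D x)) \<ge> fact n / real (n choose (n div 2)) * (1 - real (card S) / real K)"
    if x: "x \<in> S" for x
  proof -
    let ?c = "real (card (chains_through ?A x))"
    have each: "real (card (chains_through ?A x \<inter> chains_through ?A y)) \<le> ?c / real K"
      if y: "y \<in> {y\<in>S. x \<subset> y}" for y
    proof -
      have ysub: "y \<subseteq> ?A" using y S by blast
      \<comment> \<open>Here \<open>K > 0\<close> makes \<open>y\<close> a proper subset of the
        ground set, as the two-point bound requires.\<close>
      have "card y < card ?A" using size[of y] y K by simp
      then have "y \<subset> ?A" using ysub by blast
      then have "(card ?A - card x) * card (chains_through ?A x \<inter> chains_through ?A y) \<le> card (chains_through ?A x)"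
        using y by (intro card_chains_through_two_le) auto
      moreover have "K * card (chains_through ?A x \<inter> chains_through ?A y)
         \<le> (card ?A - card x) * card (chains_through ?A x \<inter> chains_through ?A y)"
        using size[OF x] by (intro mult_right_mono) auto
      ultimately have "K * card (chains_through ?A x \<inter> chains_through ?A y) \<le> card (chains_through ?A x)"
        by linarith
      then have "real K * real (card (chains_through ?A x \<inter> chains_through ?A y)) \<le> ?c"
        by (metis of_nat_le_iff of_nat_mult)
      then show ?thesis using K by (simp add: field_simps)
    qed
    have "card (chains_through ?A x \<inter> U x) \<le> (\<Sum>y\<in>{y\<in>S. x \<subset> y}. card (chains_through ?A x \<inter> chains_through ?A y))"
      unfolding U_def Int_UN_distrib using finS by (intro card_UN_le) auto
    then have "real (card (chains_through ?A x \<inter> U x))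
        \<le> (\<Sum>y\<in>{y\<in>S. x \<subset> y}. real (card (chains_through ?A x \<inter> chains_through ?A y)))"
      by (simp only: of_nat_sum[symmetric] of_nat_le_iff)
    also have "\<dots> \<le> real (card {y\<in>S. x \<subset> y}) * (?c / real K)"
      by (rule sum_bounded_above[OF each])
    also have "\<dots> \<le> real (card S) * (?c / real K)"
      using finS by (intro mult_right_mono) (auto intro: card_mono)
    finally have u: "real (card (chains_through ?A x \<inter> U x)) \<le> real (card S) * (?c / real K)" .
    have "card (chains_through ?A x) = card (D x) + card (chains_through ?A x \<inter> U x)"
      by (subst card_Un_disjoint[symmetric])
        (auto simp: D_def finite_chains_through intro: arg_cong[where f=card])
    then have "?c = real (card (D x)) + real (card (chains_through ?A x \<inter> U x))"
      by (simp only: of_nat_add)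
    moreover have "?c * (1 - real (card S) / real K) = ?c - real (card S) * (?c / real K)"
      by (simp add: right_diff_distrib)
    ultimately have "real (card (D x)) \<ge> ?c * (1 - real (card S) / real K)"
      using u by linarith
    moreover have "?c \<ge> fact n / real (n choose (n div 2))"
    proof -
      have "card x \<le> n" using size[OF x] by simp
      then have "0 < n choose card x" by simp
      moreover have "n choose card x \<le> n choose (n div 2)" by (rule binomial_maximum)
      moreover have "x \<subseteq> {1..n}" using S x by blast
      ultimately show ?thesis by (subst card_chains_through_real) (auto intro!: divide_left_mono mult_pos_pos)
    qed
    moreover have "0 \<le> 1 - real (card S) / real K" using True K by simp
    ultimately show ?thesis by (blast intro: mult_right_mono order_trans)
  qed
  have "real (card S) * (fact n / real (n choose (n div 2))) * (1 - real (card S) / real K)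
     = (\<Sum>x\<in>S. fact n / real (n choose (n div 2)) * (1 - real (card S) / real K))" by simp
  also have "\<dots> \<le> (\<Sum>x\<in>S. real (card (D x)))" by (rule sum_mono[OF D_ge])
  also have "\<dots> = real (card (\<Union>x\<in>S. D x))"
    using card_UN_disjoint'[OF D_disj _ finS] by (simp add: D_def finite_chains_through)
  also have "\<dots> \<le> real (card (\<Union>x\<in>S. chains_through {1..n} x))"
    using finS by (intro of_nat_mono card_mono) (auto simp: finite_chains_through D_def)
  finally show ?thesis .
next
  case False
  then have "1 - real (card S) / real K \<le> 0" using K by (simp add: field_simps)
  then have "real (card S) * (fact n / real (n choose (n div 2))) * (1 - real (card S) / real K) \<le> 0"
    by (intro mult_nonneg_nonpos) auto
  then show ?thesis by (rule order_trans) simp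
qed

section \<open>Binomial coefficients near the middle\<close>

text \<open>The single step from level \<open>K\<close> to level \<open>K + 1\<close> multiplies the
  coefficient by \<open>(n - K) / (K + 1)\<close>, which is at least \<open>t\<close>. Levels below
  \<open>K\<close> are no larger than level \<open>K\<close>, and high levels follow by
  symmetry.\<close>

lemma choose_far_from_middle:
  assumes n: "2 * K + 2 \<le> n" "t * (K + 1) + K \<le> n" and j: "j \<le> K \<or> n \<le> j + K" "j \<le> n"
  shows "t * (n choose j) \<le> n choose (n div 2)"
proof -
  have low: "t * (n choose i) \<le> n choose (n div 2)" if "i \<le> K" for i
  proof -
    have "(t * (n choose i)) * (K + 1) \<le> (n choose K) * (n - K)"
    proof -
      have a: "n choose i \<le> n choose K" using that n by (intro binomial_mono) auto
      have b: "t * (K + 1) \<le> n - K" using n by simp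
      show ?thesis using mult_mono[OF a b] by (simp add: algebra_simps)
    qed
    also have "\<dots> = (n choose Suc K) * (K + 1)"
      using binomial_absorb_comp[of n K] binomial_absorption[of K n] by (simp add: mult.commute)
    also have "\<dots> \<le> (n choose (n div 2)) * (K + 1)"
      by (intro mult_right_mono binomial_maximum) auto
    finally show ?thesis by (subst (asm) mult_le_cancel2) simp
  qed
  show ?thesis
  proof (cases "j \<le> K")
    case False
    then have "n - j \<le> K" using j by linarith
    from low[OF this] show ?thesis using binomial_symmetric[OF j(2)] by simp
  qed (use low in auto)
qed

text \<open>Going from level \<open>k\<close> down to \<open>k - 1\<close> multiplies the
  coefficient by \<open>k / (n - k + 1)\<close>, which tends to 1 for
  \<open>k = n div 2 - c\<close>. Induction on \<open>c\<close> uses a fixed number of such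
  steps.\<close>

lemma choose_shift_limit:
  "(\<lambda>n. real (n choose (n div 2 - c)) / real (n choose (n div 2))) \<longlonglongrightarrow> 1"
proof (induction c)
  case (Suc c)
  have lim: "(\<lambda>n. real (n div 2 - c) / real (n - (n div 2 - c) + 1)) \<longlonglongrightarrow> 1"
  proof (rule tendsto_sandwich)
    show "eventually (\<lambda>n. (real n / 2 - 1 - real c) / (real n / 2 + real c + 2) \<le> real (n div 2 - c) / real (n - (n div 2 - c) + 1)) sequentially"
      using eventually_ge_at_top[of "2 * c + 4"]
    proof eventually_elim
      case (elim n)
      show ?case by (rule frac_le) (use elim in linarith)+
    qed
    show "eventually (\<lambda>n. real (n div 2 - c) / real (n - (n div 2 - c) + 1) \<le> (real n / 2) / (real n / 2)) sequentially"
      using eventually_ge_at_top[of "2 * c + 4"]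
    proof eventually_elim
      case (elim n)
      show ?case by (rule frac_le) (use elim in linarith)+
    qed
    show "(\<lambda>n. (real n / 2 - 1 - real c) / (real n / 2 + real c + 2)) \<longlonglongrightarrow> 1" by real_asymp
    show "(\<lambda>n. (real n / 2) / (real n / 2)) \<longlonglongrightarrow> 1" by real_asymp
  qed
  have "(\<lambda>n. real (n choose (n div 2 - c)) / real (n choose (n div 2)) *
        (real (n div 2 - c) / real (n - (n div 2 - c) + 1))) \<longlonglongrightarrow> 1"
    using tendsto_mult[OF Suc lim] by (simp only: mult_1_left)
  then show ?case
  proof (rule Lim_transform_eventually)
    show "eventually (\<lambda>n. real (n choose (n div 2 - c)) / real (n choose (n div 2)) *
        (real (n div 2 - c) / real (n - (n div 2 - c) + 1))
        = real (n choose (n div 2 - Suc c)) / real (n choose (n div 2))) sequentially"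
      using eventually_ge_at_top[of "2 * c + 4"]
    proof eventually_elim
      case (elim n)
      define k where "k = n div 2 - Suc c"
      have k: "n div 2 - c = Suc k" "Suc k \<le> n" using elim by (auto simp: k_def)
      have "Suc k * (n choose Suc k) = (n - k) * (n choose k)"
        using binomial_absorb_comp[of n k] binomial_absorption[of k n] by simp
      then have "real (Suc k) * real (n choose Suc k) = real (n - k) * real (n choose k)"
        by (metis of_nat_mult)
      moreover have "n - Suc k + 1 = n - k" "n - k > 0" using k by auto
      ultimately have "real (n choose Suc k) * (real (Suc k) / real (n - Suc k + 1)) = real (n choose k)"
        by (simp add: field_simps)
      then show ?case unfolding k(1) k_def[symmetric] times_divide_eq_left by (simp only:)
    qed
  qed
qed (simp add: linorder_not_less[THEN iffD2])

text \<open>Removing one element from a ground set of size \<open>a\<close> multiplies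
  \<open>a choose k\<close> by \<open>(a - k) / a\<close>, which tends to 1/2 when \<open>k\<close>
  stays within a constant of \<open>n div 2\<close> and \<open>a\<close> within a constant of
  \<open>n\<close>.\<close>

lemma choose_drop_limit:
  "(\<lambda>n. real ((n - N) choose (n div 2 - c)) / real (n choose (n div 2))) \<longlonglongrightarrow> 1 / 2 ^ N"
proof (induction N)
  case 0 then show ?case using choose_shift_limit by simp
next
  case (Suc N)
  have lim: "(\<lambda>n. real (n - N - (n div 2 - c)) / real (n - N)) \<longlonglongrightarrow> 1 / 2"
  proof (rule tendsto_sandwich)
    show "eventually (\<lambda>n. (real n / 2 - real N) / (real n - real N) \<le> real (n - N - (n div 2 - c)) / real (n - N)) sequentially"
      using eventually_ge_at_top[of "2 * c + 2 * N + 4"]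
    proof eventually_elim
      case (elim n)
      show ?case by (rule frac_le) (use elim in linarith)+
    qed
    show "eventually (\<lambda>n. real (n - N - (n div 2 - c)) / real (n - N) \<le> (real n / 2 + 1 + real c) / (real n - real N)) sequentially"
      using eventually_ge_at_top[of "2 * c + 2 * N + 4"]
    proof eventually_elim
      case (elim n)
      show ?case by (rule frac_le) (use elim in linarith)+
    qed
    show "(\<lambda>n. (real n / 2 - real N) / (real n - real N)) \<longlonglongrightarrow> 1 / 2" by real_asymp
    show "(\<lambda>n. (real n / 2 + 1 + real c) / (real n - real N)) \<longlonglongrightarrow> 1 / 2" by real_asymp
  qed
  have "(\<lambda>n. real ((n - N) choose (n div 2 - c)) / real (n choose (n div 2)) *
        (real (n - N - (n div 2 - c)) / real (n - N))) \<longlonglongrightarrow> 1 / 2 ^ N * (1 / 2)"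
    by (intro tendsto_mult Suc lim)
  then have "(\<lambda>n. real ((n - N) choose (n div 2 - c)) / real (n choose (n div 2)) *
        (real (n - N - (n div 2 - c)) / real (n - N))) \<longlonglongrightarrow> 1 / 2 ^ Suc N"
    by (simp add: mult.commute)
  then show ?case
  proof (rule Lim_transform_eventually)
    show "eventually (\<lambda>n. real ((n - N) choose (n div 2 - c)) / real (n choose (n div 2)) *
        (real (n - N - (n div 2 - c)) / real (n - N))
        = real ((n - Suc N) choose (n div 2 - c)) / real (n choose (n div 2))) sequentially"
      using eventually_ge_at_top[of "2 * c + 2 * N + 4"]
    proof eventually_elim
      case (elim n)
      define a k where "a = n - N" and "k = n div 2 - c"
      have k: "k \<le> a" "a > 0" "n - Suc N = a - 1" using elim by (auto simp: a_def k_def)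
      have "(a - k) * (a choose k) = a * ((a - 1) choose k)"
        using binomial_absorb_comp[of a k] by simp
      then have "real (a - k) * real (a choose k) = real a * real ((a - 1) choose k)"
        by (metis of_nat_mult)
      then have "real (a choose k) * (real (a - k) / real a) = real ((a - 1) choose k)"
        using k by (simp add: field_simps)
      then show ?case unfolding k(3) a_def[symmetric] k_def[symmetric] times_divide_eq_left by (simp only:)
    qed
  qed
qed

section \<open>Convex hulls\<close>

text \<open>This is \<open>conv\<close> freed from the ambient cube, so that one notion serves for
  every \<open>n\<close> and for shifted blocks.\<close>

definition order_hull :: "'b set set \<Rightarrow> 'b set set" where
  "order_hull F = {b. \<exists>a\<in>F. \<exists>c\<in>F. a \<subseteq> b \<and> b \<subseteq> c}"

lemma subset_order_hull: "F \<subseteq> order_hull F"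
  by (auto simp: order_hull_def)

lemma hull_subset_Pow: "F \<subseteq> Pow A \<Longrightarrow> order_hull F \<subseteq> Pow A"
  by (auto simp: order_hull_def)

lemma hull_convex: "a \<in> order_hull F \<Longrightarrow> c \<in> order_hull F \<Longrightarrow> a \<subseteq> b \<Longrightarrow> b \<subseteq> c \<Longrightarrow> b \<in> order_hull F"
  unfolding order_hull_def mem_Collect_eq by (meson order_trans)

lemma conv_eq_hull: "F \<subseteq> Pow {1..n} \<Longrightarrow> conv n F = order_hull F"
  by (auto simp: conv_def order_hull_def boolean_lattice_def)

text \<open>If \<open>x \<subseteq> y\<close> held between the hulls, a member of \<open>X\<close>
  below \<open>x\<close> would lie below a member of \<open>Y\<close> above
  \<open>y\<close>.\<close>

lemma incomparable_hull: "incomparable X Y \<Longrightarrow> incomparable (order_hull X) (order_hull Y)"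
  unfolding incomparable_def order_hull_def Bex_def mem_Collect_eq by (meson order_trans)

lemma card_hull_image:
  assumes "inj g"
  shows "card (order_hull ((`) g ` F)) = card (order_hull F)"
proof -
  have "order_hull ((`) g ` F) = (`) g ` order_hull F"
  proof (intro equalityI subsetI)
    fix b assume "b \<in> order_hull ((`) g ` F)"
    then obtain a c where h: "a \<in> F" "c \<in> F" "g ` a \<subseteq> b" "b \<subseteq> g ` c" by (auto simp: order_hull_def)
    have "b = g ` (g -` b)" using h(4) by blast
    moreover have "a \<subseteq> g -` b" using h(3) by blast
    moreover have "g -` b \<subseteq> c" using h(4) assms by (auto dest!: subsetD dest: injD)
    ultimately show "b \<in> (`) g ` order_hull F" using h(1,2) unfolding order_hull_def by blast
  next
    fix b assume "b \<in> (`) g ` order_hull F"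
    then obtain x a c where h: "b = g ` x" "a \<in> F" "c \<in> F" "a \<subseteq> x" "x \<subseteq> c"
      by (auto simp: order_hull_def)
    then have "g ` a \<subseteq> b" "b \<subseteq> g ` c" by (simp_all add: image_mono)
    then show "b \<in> order_hull ((`) g ` F)" using h(2,3) by (auto simp: order_hull_def)
  qed
  moreover have "inj_on ((`) g) (order_hull F)" using assms by (auto simp: inj_on_def inj_image_eq_iff)
  ultimately show ?thesis by (simp add: card_image)
qed

text \<open>Convexity makes \<open>Pow D\<close> with \<open>H\<close> collapsed to a point acyclic; \<open>e\<close> ranks this quotient.\<close>

lemma collapsed_rank:
  assumes "finite D" "H \<subseteq> Pow D"
    and conv: "\<And>a b c. a \<in> H \<Longrightarrow> c \<in> H \<Longrightarrow> a \<subseteq> b \<Longrightarrow> b \<subseteq> c \<Longrightarrow> b \<in> H"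
  obtains e :: "'b set \<Rightarrow> nat" where
    "\<And>d d'. d \<in> H \<Longrightarrow> d' \<in> H \<Longrightarrow> e d = e d'"
    "\<And>d d'. d \<subset> d' \<Longrightarrow> d' \<subseteq> D \<Longrightarrow> \<not> (d \<in> H \<and> d' \<in> H) \<Longrightarrow> e d < e d'"
proof
  \<comment> \<open>Three layers: sets outside \<open>H\<close> with no member of \<open>H\<close>
    below them get at most \<open>card D\<close>, all of \<open>H\<close> gets
    \<open>card D + 1\<close>, and sets outside \<open>H\<close> above a member of it get at least
    \<open>card D + 2\<close>. By convexity no set of the top layer lies below a member of
    \<open>H\<close>.\<close>
  define e where "e d = (if d \<in> H then card D + 1
     else if \<exists>h\<in>H. h \<subseteq> d then card d + card D + 2 else card d)" for d
  show "e d = e d'" if "d \<in> H" "d' \<in> H" for d d' using that by (simp add: e_def)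
  show "e d < e d'" if h: "d \<subset> d'" "d' \<subseteq> D" "\<not> (d \<in> H \<and> d' \<in> H)" for d d'
  proof -
    have "finite d'" using h(2) assms(1) finite_subset by blast
    then have "card d < card d'" "card d' \<le> card D"
      using h assms(1) by (auto intro: psubset_card_mono card_mono)
    moreover have "d \<in> H \<Longrightarrow> \<exists>h\<in>H. h \<subseteq> d'" using h by blast
    moreover have "\<exists>h\<in>H. h \<subseteq> d \<Longrightarrow> \<exists>h\<in>H. h \<subseteq> d'" using h by blast
    moreover have "\<exists>h\<in>H. h \<subseteq> d \<Longrightarrow> d' \<in> H \<Longrightarrow> d \<in> H" using h conv by blast
    ultimately show ?thesis using h(3) unfolding e_def by auto
  qed
qed

section \<open>Packing copies\<close>

text \<open>Both kinds of embeddings are instances of a property \<open>E\<close> of maps \<open>P \<Rightarrow> nat set\<close> that only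
  depends on the inclusions between the values.\<close>

locale copies =
  fixes P :: "'a set" and E :: "('a \<Rightarrow> nat set) \<Rightarrow> bool"
  assumes nonempty: "P \<noteq> {}"
    and transfer: "\<And>f g. E f \<Longrightarrow> (\<And>a b. a \<in> P \<Longrightarrow> b \<in> P \<Longrightarrow> f a \<subseteq> f b \<longleftrightarrow> g a \<subseteq> g b) \<Longrightarrow> E g"
    and exists_copy: "\<exists>n\<ge>1. \<exists>f. E f \<and> f ` P \<subseteq> Pow {1..n}"
begin

definition is_copy :: "nat set set \<Rightarrow> bool" where
  "is_copy X \<longleftrightarrow> (\<exists>f. E f \<and> X = f ` P)"

text \<open>In the two instances this becomes \<open>t1\<close> and \<open>t2\<close>, and
  \<open>packing_number\<close> becomes \<open>M1\<close> and \<open>M2\<close>.\<close>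

definition hull_size :: nat where
  "hull_size = (LEAST k. \<exists>n\<ge>1. \<exists>f. E f \<and> f ` P \<subseteq> Pow {1..n} \<and> k = card (order_hull (f ` P)))"

definition packing :: "nat \<Rightarrow> nat \<Rightarrow> bool" where
  "packing n M \<longleftrightarrow> (\<exists>f. (\<forall>i\<in>{1..M}. E (f i) \<and> f i ` P \<subseteq> Pow {1..n}) \<and>
     pairwise (\<lambda>i j. incomparable (f i ` P) (f j ` P)) {1..M})"

definition packing_number :: "nat \<Rightarrow> nat" where
  "packing_number n = (GREATEST M. packing n M)"

lemma is_copy_nonempty: "is_copy X \<Longrightarrow> X \<noteq> {}"
  using nonempty by (auto simp: is_copy_def)

text \<open>Used to recognise shifts, translates and joins with outside sets as copies.\<close>

lemma is_copy_image:
  assumes "is_copy X" "\<And>x y. x \<in> X \<Longrightarrow> y \<in> X \<Longrightarrow> x \<subseteq> y \<longleftrightarrow> g x \<subseteq> g y"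
  shows "is_copy (g ` X)"
proof -
  obtain f where f: "E f" "X = f ` P" using assms(1) by (auto simp: is_copy_def)
  have "E (g \<circ> f)" by (rule transfer[OF f(1)]) (use assms(2) f(2) in auto)
  then show ?thesis unfolding is_copy_def using f(2) by (metis image_comp)
qed

lemma optimal_copy:
  obtains m X where "m \<ge> 1" "is_copy X" "X \<subseteq> Pow {1..m}" "card (order_hull X) = hull_size"
proof -
  have "\<exists>k n. n \<ge> 1 \<and> (\<exists>f. E f \<and> f ` P \<subseteq> Pow {1..n} \<and> k = card (order_hull (f ` P)))"
    using exists_copy by blast
  then have "\<exists>n\<ge>1. \<exists>f. E f \<and> f ` P \<subseteq> Pow {1..n} \<and> hull_size = card (order_hull (f ` P))"
    unfolding hull_size_def by (rule LeastI_ex)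
  then show ?thesis using that unfolding is_copy_def by metis
qed

lemma hull_size_le:
  assumes "n \<ge> 1" "is_copy X" "X \<subseteq> Pow {1..n}"
  shows "hull_size \<le> card (order_hull X)"
  unfolding hull_size_def by (rule Least_le) (use assms in \<open>auto simp: is_copy_def\<close>)

lemma hull_size_bounds:
  assumes "X \<subseteq> Pow {1..m}" "card (order_hull X) = hull_size" "is_copy X"
  shows "0 < hull_size" "hull_size \<le> 2 ^ m"
proof -
  have sub: "order_hull X \<subseteq> Pow {1..m}" using assms(1) by (rule hull_subset_Pow)
  then have fin: "finite (order_hull X)" by (rule finite_subset) simp
  have "order_hull X \<noteq> {}" using is_copy_nonempty[OF assms(3)] subset_order_hull by blast
  then show "0 < hull_size" using fin assms(2) by (metis card_gt_0_iff)
  have "card (order_hull X) \<le> card (Pow {1..m})" using sub by (intro card_mono) auto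
  then show "hull_size \<le> 2 ^ m" using assms(2) by (simp add: card_Pow)
qed

text \<open>The images of one fixed element of \<open>P\<close> are distinct subsets of the ground
  set. The bound makes the \<open>GREATEST\<close> in \<open>packing_number\<close> well
  defined.\<close>

lemma packing_bounded: "packing n M \<Longrightarrow> M \<le> 2 ^ n"
proof -
  assume "packing n M"
  then obtain f where f: "\<And>i. i \<in> {1..M} \<Longrightarrow> f i ` P \<subseteq> Pow {1..n}"
     "pairwise (\<lambda>i j. incomparable (f i ` P) (f j ` P)) {1..M}"
    unfolding packing_def by blast
  obtain a where a: "a \<in> P" using nonempty by blast
  have "inj_on (\<lambda>i. f i a) {1..M}"
  proof (rule inj_onI, rule ccontr)
    fix i j assume h: "i \<in> {1..M}" "j \<in> {1..M}" "f i a = f j a" "i \<noteq> j"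
    then have "incomparable (f i ` P) (f j ` P)" using f(2) unfolding pairwise_def by blast
    then show False using a h(3) unfolding incomparable_def by blast
  qed
  moreover have "(\<lambda>i. f i a) ` {1..M} \<subseteq> Pow {1..n}" using f(1) a by blast
  ultimately have "card {1..M} \<le> card (Pow {1..n})" by (intro card_inj_on_le) auto
  then show ?thesis by (simp add: card_Pow)
qed

lemma packing_packing_number: "packing n (packing_number n)"
proof -
  have "packing n 0" by (simp add: packing_def)
  then show ?thesis unfolding packing_number_def
    using packing_bounded by (rule GreatestI_nat)
qed

lemma packing_number_ge: "packing n M \<Longrightarrow> M \<le> packing_number n"
  unfolding packing_number_def by (rule Greatest_le_nat[OF _ packing_bounded])

lemma packing_number_ge_card:
  assumes "finite \<F>" "\<And>X. X \<in> \<F> \<Longrightarrow> is_copy X" "\<And>X. X \<in> \<F> \<Longrightarrow> X \<subseteq> Pow {1..n}"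
    and "\<And>X Y. X \<in> \<F> \<Longrightarrow> Y \<in> \<F> \<Longrightarrow> X \<noteq> Y \<Longrightarrow> incomparable X Y"
  shows "card \<F> \<le> packing_number n"
proof -
  obtain h where h: "bij_betw h {1..card \<F>} \<F>"
    using ex_bij_betw_nat_finite_1[OF assms(1)] by blast
  have "\<forall>X\<in>\<F>. \<exists>f. E f \<and> X = f ` P" using assms(2) by (auto simp: is_copy_def)
  then obtain F where F: "\<And>X. X \<in> \<F> \<Longrightarrow> E (F X) \<and> X = F X ` P" by metis
  have hF: "h i \<in> \<F>" if "i \<in> {1..card \<F>}" for i using h that by (auto simp: bij_betw_def)
  have img: "F (h i) ` P = h i" if "i \<in> {1..card \<F>}" for i using F hF[OF that] by metis
  have "packing n (card \<F>)"
    unfolding packing_def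
  proof (intro exI conjI ballI)
    fix i assume i: "i \<in> {1..card \<F>}"
    show "E (F (h i))" using F hF[OF i] by blast
    show "F (h i) ` P \<subseteq> Pow {1..n}" using img[OF i] assms(3)[OF hF[OF i]] by simp
  next
    show "pairwise (\<lambda>i j. incomparable (F (h i) ` P) (F (h j) ` P)) {1..card \<F>}"
    proof (rule pairwiseI)
      fix i j assume ij: "i \<in> {1..card \<F>}" "j \<in> {1..card \<F>}" "i \<noteq> j"
      have "h i \<noteq> h j" using bij_betw_imp_inj_on[OF h] ij by (simp add: inj_on_eq_iff)
      then show "incomparable (F (h i) ` P) (F (h j) ` P)"
        unfolding img[OF ij(1)] img[OF ij(2)] by (intro assms(4) hF ij)
    qed
  qed
  then show ?thesis by (rule packing_number_ge)
qed

subsection \<open>Upper bound\<close>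

lemma card_chains_meeting_hull_ge:
  assumes X: "is_copy X" "X \<subseteq> Pow {1..n}" and K: "K > 0"
    and n: "2 * K + 2 \<le> n" "hull_size * (K + 1) + K \<le> n"
  shows "real (card (\<Union>x\<in>order_hull X. chains_through {1..n} x))
     \<ge> real hull_size * (fact n / real (n choose (n div 2))) * (1 - real hull_size / real K)"
    (is "?R \<ge> ?L")
proof -
  let ?H = "order_hull X" and ?C = "n choose (n div 2)"
  have sub: "?H \<subseteq> Pow {1..n}" using X(2) by (rule hull_subset_Pow)
  then have fin: "finite ?H" by (rule finite_subset) simp
  have C: "?C > 0" by simp
  have mono: "card (\<Union>x\<in>S. chains_through {1..n} x) \<le> card (\<Union>x\<in>?H. chains_through {1..n} x)"
    if "S \<subseteq> ?H" for S
    using that fin by (intro card_mono) (auto simp: finite_chains_through)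
  show ?thesis
  \<comment> \<open>In the first case the chains through this one \<open>x\<close> are already
    numerous enough. In the second every member of the hull is far from the top.\<close>
  proof (cases "\<exists>x\<in>?H. hull_size * (n choose card x) \<le> ?C")
    case True
    then obtain x where x: "x \<in> ?H" "hull_size * (n choose card x) \<le> ?C" by blast
    have xs: "x \<subseteq> {1..n}" using x sub by blast
    have "card x \<le> n" using card_mono[OF _ xs] by simp
    then have pos: "real (n choose card x) > 0" by simp
    have le: "real hull_size * real (n choose card x) \<le> real ?C"
      using x(2) by (metis of_nat_le_iff of_nat_mult)
    have "?L \<le> real hull_size * (fact n / real ?C)"
      using K by (intro mult_left_le) auto
    also have "\<dots> = fact n * (real hull_size / real ?C)" by simp
    also have "\<dots> \<le> fact n * (1 / real (n choose card x))"
      using le pos C by (intro mult_left_mono) (auto simp: field_simps)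
    also have "\<dots> = real (card (chains_through {1..n} x))"
      using card_chains_through_real[OF xs] by simp
    also have "\<dots> \<le> ?R" using mono[of "{x}"] x(1) by simp
    finally show ?thesis .
  next
    case False
    have "n \<ge> 1" using n by simp
    \<comment> \<open>Passing to exactly \<open>hull_size\<close> members keeps the error term
      independent of the actual hull, whose size may grow with \<open>n\<close>.\<close>
    then obtain S where S: "S \<subseteq> ?H" "card S = hull_size"
      using hull_size_le[OF _ X] obtain_subset_with_card_n by metis
    have "real (card S) * (fact n / real (n choose (n div 2))) * (1 - real (card S) / real K)
        \<le> real (card (\<Union>x\<in>S. chains_through {1..n} x))"
    proof (rule card_chains_meeting_ge)
      show "S \<subseteq> Pow {1..n}" using S sub by blast
      fix x assume "x \<in> S"
      then have x: "x \<in> ?H" using S by blast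
      then have "x \<subseteq> {1..n}" using sub by blast
      then have "card x \<le> n" using card_mono[of "{1..n}" x] by simp
      then show "card x + K \<le> n"
        using choose_far_from_middle[OF n, of "card x"] False x by force
    qed (rule K)
    also have "\<dots> \<le> ?R" using mono[OF S(1)] by simp
    finally show ?thesis using S(2) by simp
  qed
qed

text \<open>No chain meets the hulls of two different copies, since members of one chain are
  comparable. So the counts of chains meeting the individual hulls add up to at most
  \<open>fact n\<close>.\<close>

lemma packing_number_upper:
  assumes K: "K > 0" and n: "2 * K + 2 \<le> n" "hull_size * (K + 1) + K \<le> n"
  shows "real (packing_number n) / real (n choose (n div 2)) * (real hull_size * (1 - real hull_size / real K)) \<le> 1"
proof -
  let ?M = "packing_number n" and ?C = "n choose (n div 2)"
  obtain f where f: "\<And>i. i \<in> {1..?M} \<Longrightarrow> E (f i)" "\<And>i. i \<in> {1..?M} \<Longrightarrow> f i ` P \<subseteq> Pow {1..n}"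
     "pairwise (\<lambda>i j. incomparable (f i ` P) (f j ` P)) {1..?M}"
    using packing_packing_number[of n] unfolding packing_def by blast
  define D where "D i = (\<Union>x\<in>order_hull (f i ` P). chains_through {1..n} x)" for i
  have finH: "finite (order_hull (f i ` P))" if "i \<in> {1..?M}" for i
    using hull_subset_Pow[OF f(2)[OF that]] by (rule finite_subset) simp
  have disj: "disjoint_family_on D {1..?M}"
    unfolding disjoint_family_on_def
  proof (intro ballI impI, rule ccontr)
    fix i j assume ij: "i \<in> {1..?M}" "j \<in> {1..?M}" "i \<noteq> j" and "D i \<inter> D j \<noteq> {}"
    then obtain xs x y where h: "x \<in> order_hull (f i ` P)" "y \<in> order_hull (f j ` P)"
      "xs \<in> chains_through {1..n} x" "xs \<in> chains_through {1..n} y" unfolding D_def by blast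
    have "incomparable (order_hull (f i ` P)) (order_hull (f j ` P))"
      using f(3) ij unfolding pairwise_def by (blast intro: incomparable_hull)
    then show False using h chains_through_comparable unfolding incomparable_def by blast
  qed
  have "real ?M * (real hull_size * (fact n / real ?C) * (1 - real hull_size / real K))
     = (\<Sum>i\<in>{1..?M}. real hull_size * (fact n / real ?C) * (1 - real hull_size / real K))" by simp
  also have "\<dots> \<le> (\<Sum>i\<in>{1..?M}. real (card (D i)))"
    unfolding D_def using f(1,2) K n
    by (intro sum_mono card_chains_meeting_hull_ge) (auto simp: is_copy_def)
  also have "\<dots> = real (card (\<Union>i\<in>{1..?M}. D i))"
    using card_UN_disjoint'[OF disj] finH by (simp add: D_def finite_chains_through)
  also have "\<dots> \<le> real (card (permutations_of_set {1..n}))"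
    using chains_through_subset by (intro of_nat_mono card_mono) (auto simp: D_def)
  also have "\<dots> = fact n" by simp
  finally have "fact n * (real ?M / real ?C * (real hull_size * (1 - real hull_size / real K))) \<le> fact n * 1"
    by (simp add: mult_ac)
  then show ?thesis by (subst (asm) mult_le_cancel_left_pos) auto
qed

subsection \<open>Lower bound\<close>

text \<open>Members of rank \<open>w\<close> will be joined with sets of size \<open>k - w\<close> outside \<open>{1..N}\<close>: an inclusion
  between joins of different copies would force a larger rank, hence a smaller set outside.\<close>

definition ranked_family :: "nat \<Rightarrow> nat set set set \<Rightarrow> (nat set \<Rightarrow> nat) \<Rightarrow> bool" where
  "ranked_family N \<F> w \<longleftrightarrow> \<F> \<subseteq> Pow (Pow {1..N}) \<and> (\<forall>X\<in>\<F>. is_copy X) \<and>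
     (\<forall>X\<in>\<F>. \<forall>x\<in>X. \<forall>y\<in>X. w x = w y) \<and>
     (\<forall>X\<in>\<F>. \<forall>Y\<in>\<F>. \<forall>x\<in>X. \<forall>y\<in>Y. X \<noteq> Y \<longrightarrow> x \<subseteq> y \<longrightarrow> w x < w y)"

lemma ranked_family_finite: "ranked_family N \<F> w \<Longrightarrow> finite \<F>"
  unfolding ranked_family_def by (metis finite_Pow_iff finite_atLeastAtMost finite_subset)

text \<open>On the product of \<open>Pow {1..N}\<close> with a block \<open>Pow {N + 1..N + m}\<close> containing an optimal hull
  \<open>H\<close>, translate the copy by all points over \<open>H\<close>, and repeat the given family over every other point
  of the block. Convexity of \<open>H\<close> makes the order lexicographic.\<close>

lemma ranked_family_step:
  assumes fam: "ranked_family N \<F> w"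
    and Q: "is_copy Q" "Q \<subseteq> Pow {N + 1..N + m}" "card (order_hull Q) = s"
  shows "\<exists>\<F>' w'. ranked_family (N + m) \<F>' w' \<and> card \<F>' = 2 ^ N + (2 ^ m - s) * card \<F>"
proof -
  define D where "D = {N + 1..N + m}"
  define H where "H = order_hull Q"
  have HD: "H \<subseteq> Pow D" using Q(2) unfolding H_def D_def by (rule hull_subset_Pow)
  have QH: "Q \<subseteq> H" unfolding H_def by (rule subset_order_hull)
  have finD: "finite D" by (simp add: D_def)
  have finF: "finite \<F>" using fam by (rule ranked_family_finite)
  obtain e :: "nat set \<Rightarrow> nat" where e: "\<And>d d'. d \<in> H \<Longrightarrow> d' \<in> H \<Longrightarrow> e d = e d'"
    "\<And>d d'. d \<subset> d' \<Longrightarrow> d' \<subseteq> D \<Longrightarrow> \<not> (d \<in> H \<and> d' \<in> H) \<Longrightarrow> e d < e d'"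
  proof (rule collapsed_rank[OF finD HD])
    show "b \<in> H" if "a \<in> H" "c \<in> H" "a \<subseteq> b" "b \<subseteq> c" for a b c
      using that unfolding H_def by (rule hull_convex)
  qed (rule that)
  have fam': "\<forall>X\<in>\<F>. is_copy X" "\<forall>X\<in>\<F>. \<forall>x\<in>X. \<forall>y\<in>X. w x = w y"
    "\<forall>X\<in>\<F>. \<forall>Y\<in>\<F>. \<forall>x\<in>X. \<forall>y\<in>Y. X \<noteq> Y \<longrightarrow> x \<subseteq> y \<longrightarrow> w x < w y"
    and sub': "\<F> \<subseteq> Pow (Pow {1..N})"
    using fam unfolding ranked_family_def by - (elim conjE, assumption)+
  have F1: "X \<subseteq> Pow {1..N}" if "X \<in> \<F>" for X using sub' that by auto
  note F = F1 fam'[rule_format]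
  \<comment> \<open>\<open>B\<close> exceeds both possible second ranks, \<open>card x\<close> and
    \<open>w x\<close>, and so can serve as the base of a lexicographic encoding.\<close>
  define B where "B = N + 1 + (\<Sum>x\<in>Pow {1..N}. w x)"
  have wB: "w x < B" if "x \<subseteq> {1..N}" for x
  proof -
    have "w x \<le> (\<Sum>x\<in>Pow {1..N}. w x)" using that by (intro member_le_sum) auto
    then show ?thesis by (simp add: B_def)
  qed
  have cB: "card x < B" if "x \<subseteq> {1..N}" for x
    using card_mono[OF _ that] by (simp add: B_def)
  \<comment> \<open>Over \<open>H\<close> the copies are indexed by their point \<open>x\<close> of
    the old cube, ranked by cardinality; over any other \<open>d\<close> they are the old copies
    with their old rank.\<close>
  define v where "v d x = (if d \<in> H then card x else w x)" for d x
  have vB: "v d x < B" if "x \<subseteq> {1..N}" for d x using wB cB that by (simp add: v_def)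
  define w' where "w' z = e (z \<inter> D) * B + v (z \<inter> D) (z \<inter> {1..N})" for z
  have split: "(x \<union> d) \<inter> D = d" "(x \<union> d) \<inter> {1..N} = x" if "x \<subseteq> {1..N}" "d \<subseteq> D" for x d
    using that by (auto simp: D_def)
  have w'_eq: "w' (x \<union> d) = e d * B + v d x" if "x \<subseteq> {1..N}" "d \<subseteq> D" for x d
    using split[OF that] by (simp add: w'_def)
  have sub_iff: "x \<union> d \<subseteq> x' \<union> d' \<longleftrightarrow> x \<subseteq> x' \<and> d \<subseteq> d'"
    if "x \<subseteq> {1..N}" "d \<subseteq> D" "x' \<subseteq> {1..N}" "d' \<subseteq> D" for x d x' d'
    using split[OF that(1,2)] split[OF that(3,4)] by blast
  have w'_less: "w' (x \<union> d) < w' (x' \<union> d')"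
    if h: "x \<subseteq> {1..N}" "x' \<subseteq> {1..N}" "d \<subset> d'" "d' \<subseteq> D" "\<not> (d \<in> H \<and> d' \<in> H)" for x x' d d'
  proof -
    have "(e d + 1) * B \<le> e d' * B" using e(2)[OF h(3-5)] by (intro mult_right_mono) auto
    then have "e d * B + v d x < e d' * B + v d' x'" using vB[OF h(1), of d] by simp
    then show ?thesis using w'_eq h by auto
  qed
  define T where "T = (\<lambda>(X, d :: nat set). (\<lambda>x. x \<union> d) ` X)"
  define T' where "T' x = (\<lambda>h. x \<union> h) ` Q" for x
  define \<F>1 where "\<F>1 = T ` (\<F> \<times> (Pow D - H))"
  define \<F>2 where "\<F>2 = T' ` Pow {1..N}"
  have elem1: "\<exists>X d. X \<in> \<F> \<and> d \<subseteq> D \<and> d \<notin> H \<and> Z = T (X, d)" if "Z \<in> \<F>1" for Z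
    using that unfolding \<F>1_def by auto
  have elem2: "\<exists>x. x \<subseteq> {1..N} \<and> Z = T' x" if "Z \<in> \<F>2" for Z
    using that unfolding \<F>2_def by auto
  have mem1: "\<exists>x\<in>X. z = x \<union> d \<and> x \<subseteq> {1..N}" if "z \<in> T (X, d)" "X \<in> \<F>" for z X d
    using that F(1) unfolding T_def by auto
  have mem2: "\<exists>h\<in>Q. z = x \<union> h \<and> h \<in> H \<and> h \<subseteq> D" if "z \<in> T' x" for z x
    using that QH HD unfolding T'_def by auto
  have copy1: "is_copy (T (X, d))" if "X \<in> \<F>" "d \<subseteq> D" for X d
  proof -
    have "is_copy ((\<lambda>x. x \<union> d) ` X)"
    proof (rule is_copy_image[OF F(2)[OF that(1)]])
      fix a b assume "a \<in> X" "b \<in> X"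
      then have "a \<subseteq> {1..N}" "b \<subseteq> {1..N}" using F(1)[OF that(1)] by auto
      then show "a \<subseteq> b \<longleftrightarrow> a \<union> d \<subseteq> b \<union> d" using sub_iff[of a d b d] that(2) by simp
    qed
    then show ?thesis by (simp add: T_def)
  qed
  have copy2: "is_copy (T' x)" if "x \<subseteq> {1..N}" for x
    unfolding T'_def
  proof (rule is_copy_image[OF Q(1)])
    fix a b assume "a \<in> Q" "b \<in> Q"
    then have "a \<subseteq> D" "b \<subseteq> D" using QH HD by auto
    then show "a \<subseteq> b \<longleftrightarrow> x \<union> a \<subseteq> x \<union> b" using sub_iff[OF that _ that] by simp
  qed
  have nonemptyT: "T (X, d) \<noteq> {}" if "X \<in> \<F>" for X d
    using is_copy_nonempty[OF F(2)[OF that]] by (simp add: T_def)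
  have nonemptyQ: "Q \<noteq> {}" using Q(1) by (rule is_copy_nonempty)
  have inj1: "inj_on T (\<F> \<times> (Pow D - H))"
  proof (rule inj_onI)
    fix p q assume p: "p \<in> \<F> \<times> (Pow D - H)" and q: "q \<in> \<F> \<times> (Pow D - H)" and eq: "T p = T q"
    obtain X d Y d' where pq: "p = (X, d)" "q = (Y, d')" by (cases p, cases q)
    \<comment> \<open>\<open>X\<close> is recovered by projecting to the old cube, and
      \<open>d\<close> is the block part of any member.\<close>
    have rec: "(\<lambda>z. z \<inter> {1..N}) ` T (Z, c) = Z" if "Z \<in> \<F>" "c \<subseteq> D" for Z c
    proof -
      have "(\<lambda>z. z \<inter> {1..N}) ` T (Z, c) = (\<lambda>x. (x \<union> c) \<inter> {1..N}) ` Z"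
        by (simp add: T_def image_image)
      also have "\<dots> = (\<lambda>x. x) ` Z"
        using F(1)[OF that(1)] that(2) by (intro image_cong refl split(2)) auto
      finally show ?thesis by simp
    qed
    have "X = Y" using rec[of X d] rec[of Y d'] p q pq eq by auto
    moreover have "d = d'"
    proof -
      obtain z where z: "z \<in> T (X, d)" using nonemptyT p pq by blast
      then have "z \<inter> D = d" using mem1[OF z] split(1) p pq by auto
      moreover have "z \<in> T (Y, d')" using z eq pq by simp
      then have "z \<inter> D = d'" using mem1[of z Y d'] split(1) q pq by auto
      ultimately show ?thesis by simp
    qed
    ultimately show "p = q" using pq by simp
  qed
  have inj2: "inj_on T' (Pow {1..N})"
  proof (rule inj_onI)
    fix x y assume h: "x \<in> Pow {1..N}" "y \<in> Pow {1..N}" "T' x = T' y"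
    obtain c where c: "c \<in> Q" using nonemptyQ by blast
    then have "x \<union> c \<in> T' y" using h(3) unfolding T'_def by blast
    from mem2[OF this] obtain c' where "x \<union> c = y \<union> c'" "c' \<subseteq> D" by blast
    moreover have "c \<subseteq> D" using c QH HD by blast
    ultimately show "x = y" using h(1,2) split(2) by (metis PowD)
  qed
  \<comment> \<open>Block parts lie outside \<open>H\<close> for members of \<open>\<F>1\<close> and
    inside \<open>H\<close> for members of \<open>\<F>2\<close>.\<close>
  have disj: "\<F>1 \<inter> \<F>2 = {}"
  proof (rule ccontr)
    assume "\<F>1 \<inter> \<F>2 \<noteq> {}"
    then obtain Z where "Z \<in> \<F>1" "Z \<in> \<F>2" by blast
    then obtain X d x where h: "X \<in> \<F>" "d \<subseteq> D" "d \<notin> H" "Z = T (X, d)" "x \<subseteq> {1..N}" "Z = T' x"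
      using elem1 elem2 by metis
    obtain z where z: "z \<in> Z" using nonemptyT h(1,4) by blast
    then obtain y where "z = y \<union> d" "y \<subseteq> {1..N}" using mem1[of z X d] h(1,4) by blast
    then have "z \<inter> D = d" using split(1) h(2) by blast
    moreover obtain c where "z = x \<union> c" "c \<in> H" "c \<subseteq> D" using mem2[of z x] z h(6) by blast
    then have "z \<inter> D \<in> H" using split(1) h(5) by metis
    ultimately show False using h(3) by simp
  qed
  have "card (\<F>1 \<union> \<F>2) = card \<F>1 + card \<F>2"
    using finF finD disj by (intro card_Un_disjoint) (auto simp: \<F>1_def \<F>2_def)
  moreover have "card \<F>2 = 2 ^ N"
    unfolding \<F>2_def using inj2 by (simp add: card_image card_Pow)
  moreover have "card \<F>1 = card \<F> * (2 ^ m - s)"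
  proof -
    have "card (Pow D - H) = 2 ^ m - s"
      using HD finD Q(3) by (subst card_Diff_subset) (auto simp: H_def D_def card_Pow intro: finite_subset)
    then show ?thesis unfolding \<F>1_def using inj1 by (simp add: card_image card_cartesian_product)
  qed
  ultimately have card: "card (\<F>1 \<union> \<F>2) = 2 ^ N + (2 ^ m - s) * card \<F>" by simp
  have elem: "(\<exists>X d. X \<in> \<F> \<and> d \<subseteq> D \<and> d \<notin> H \<and> Z = T (X, d)) \<or> (\<exists>x. x \<subseteq> {1..N} \<and> Z = T' x)"
    if "Z \<in> \<F>1 \<union> \<F>2" for Z using that elem1 elem2 by blast
  have "ranked_family (N + m) (\<F>1 \<union> \<F>2) w'"
    unfolding ranked_family_def
  proof (intro conjI ballI impI subsetI)
    fix Z assume Z: "Z \<in> \<F>1 \<union> \<F>2"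
    have "{1..N} \<union> D = {1..N + m}" by (auto simp: D_def)
    moreover have "z \<subseteq> {1..N} \<union> D" if "z \<in> Z" for z
      using elem[OF Z] that mem1 mem2 by blast
    ultimately show "Z \<in> Pow (Pow {1..N + m})" by auto
    show "is_copy Z" using elem[OF Z] copy1 copy2 by blast
    show "w' z = w' z'" if z: "z \<in> Z" "z' \<in> Z" for z z'
      using elem[OF Z]
    proof (elim disjE exE conjE)
      fix X d assume h: "X \<in> \<F>" "d \<subseteq> D" "d \<notin> H" "Z = T (X, d)"
      obtain x x' where x: "x \<in> X" "z = x \<union> d" "x \<subseteq> {1..N}" "x' \<in> X" "z' = x' \<union> d" "x' \<subseteq> {1..N}"
        using mem1 z h by metis
      show ?thesis using x h w'_eq F(3)[OF h(1) x(1,4)] by (simp add: v_def)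
    next
      fix x assume h: "x \<subseteq> {1..N}" "Z = T' x"
      obtain c c' where c: "z = x \<union> c" "c \<in> H" "c \<subseteq> D" "z' = x \<union> c'" "c' \<in> H" "c' \<subseteq> D"
        using mem2 z h(2) by metis
      then show ?thesis using h w'_eq e(1)[OF c(2,5)] by (simp add: v_def)
    qed
  next
    fix Z Z' z z' assume Z: "Z \<in> \<F>1 \<union> \<F>2" "Z' \<in> \<F>1 \<union> \<F>2" "z \<in> Z" "z' \<in> Z'" "Z \<noteq> Z'" "z \<subseteq> z'"
    have shape: "\<exists>x d. z = x \<union> d \<and> x \<subseteq> {1..N} \<and> d \<subseteq> D \<and>
        (d \<in> H \<and> Z = T' x \<or> d \<notin> H \<and> (\<exists>X\<in>\<F>. x \<in> X \<and> Z = T (X, d)))"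
      if "Z \<in> \<F>1 \<union> \<F>2" "z \<in> Z" for Z z
      using elem[OF that(1)]
    proof (elim disjE exE conjE)
      fix X d assume h: "X \<in> \<F>" "d \<subseteq> D" "d \<notin> H" "Z = T (X, d)"
      then show ?thesis using mem1[of z X d] that(2) by blast
    next
      fix x assume h: "x \<subseteq> {1..N}" "Z = T' x"
      then show ?thesis using mem2[of z x] that(2) by blast
    qed
    obtain x d where x: "z = x \<union> d" "x \<subseteq> {1..N}" "d \<subseteq> D"
      "d \<in> H \<and> Z = T' x \<or> d \<notin> H \<and> (\<exists>X\<in>\<F>. x \<in> X \<and> Z = T (X, d))"
      using shape[OF Z(1,3)] by blast
    obtain x' d' where x': "z' = x' \<union> d'" "x' \<subseteq> {1..N}" "d' \<subseteq> D"
      "d' \<in> H \<and> Z' = T' x' \<or> d' \<notin> H \<and> (\<exists>X\<in>\<F>. x' \<in> X \<and> Z' = T (X, d'))"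
      using shape[OF Z(2,4)] by blast
    have sub: "x \<subseteq> x'" "d \<subseteq> d'" using sub_iff x x' Z(6) by blast+
    \<comment> \<open>In the first two cases the block rank is the same and the second rank decides:
      different translates of \<open>Q\<close> have different points, and over a common
      \<open>d\<close> the old family applies. In the third case the block rank alone
      increases.\<close>
    consider "d \<in> H" "d' \<in> H" | "d = d'" "d \<notin> H" | "d \<subset> d'" "\<not> (d \<in> H \<and> d' \<in> H)"
      using sub(2) by blast
    then show "w' z < w' z'"
    proof cases
      case 1
      then have "x \<noteq> x'" using x(4) x'(4) Z(5) by blast
      then have "card x < card x'"
        using sub(1) x'(2) by (intro psubset_card_mono) (auto intro: finite_subset)
      then show ?thesis using 1 e(1)[OF 1] w'_eq x x' by (simp add: v_def)
    next
      case 2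
      then obtain X Y where XY: "X \<in> \<F>" "x \<in> X" "Z = T (X, d)" "Y \<in> \<F>" "x' \<in> Y" "Z' = T (Y, d)"
        using x(4) x'(4) by blast
      then have "w x < w x'" using F(4)[OF XY(1,4,2,5)] sub(1) Z(5) by blast
      then show ?thesis using 2 w'_eq x x' by (simp add: v_def)
    next
      case 3
      then show ?thesis using w'_less x x' by simp
    qed
  qed
  then show ?thesis using card by blast
qed

text \<open>Adding \<open>N\<close> to every element moves the copy into the next block.\<close>

lemma shifted_copy:
  assumes "is_copy X" "X \<subseteq> Pow {1..m}"
  shows "\<exists>Q. is_copy Q \<and> Q \<subseteq> Pow {N + 1..N + m} \<and> card (order_hull Q) = card (order_hull X)"
proof (intro exI conjI)
  have inj: "inj ((+) N)" by (simp add: inj_def)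
  show "is_copy ((`) ((+) N) ` X)"
    using assms(1) inj by (intro is_copy_image) (auto simp: inj_image_subset_iff)
  show "(`) ((+) N) ` X \<subseteq> Pow {N + 1..N + m}" using assms(2) by fastforce
  show "card (order_hull ((`) ((+) N) ` X)) = card (order_hull X)" by (rule card_hull_image[OF inj])
qed

text \<open>Each translate of the hull takes up \<open>hull_size\<close> points, and the points left
  over are those with every block coordinate outside the hull,
  \<open>(2 ^ m - hull_size) ^ q\<close> in number. Formally this solves the recurrence for the
  family size given by adding one block.\<close>

lemma ranked_family_exists:
  assumes X: "is_copy X" "X \<subseteq> Pow {1..m}" "card (order_hull X) = hull_size"
  shows "\<exists>\<F> w. ranked_family (q * m) \<F> w \<and>
     real (card \<F>) * real hull_size = 2 ^ (q * m) - (2 ^ m - real hull_size) ^ q"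
proof (induction q)
  case 0
  have "ranked_family 0 {} (\<lambda>_. 0)" by (simp add: ranked_family_def)
  then show ?case by (intro exI[of _ "{}"]) auto
next
  case (Suc q)
  then obtain \<F> w where F: "ranked_family (q * m) \<F> w"
    "real (card \<F>) * real hull_size = 2 ^ (q * m) - (2 ^ m - real hull_size) ^ q" by blast
  obtain Q where Q: "is_copy Q" "Q \<subseteq> Pow {q * m + 1..q * m + m}" "card (order_hull Q) = hull_size"
    using shifted_copy[OF X(1,2)] X(3) by metis
  obtain \<F>' w' where F': "ranked_family (q * m + m) \<F>' w'"
    "card \<F>' = 2 ^ (q * m) + (2 ^ m - hull_size) * card \<F>"
    using ranked_family_step[OF F(1) Q] by blast
  \<comment> \<open>This makes the natural-number difference in the recurrence a genuine
    one.\<close>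
  have "hull_size \<le> 2 ^ m" using hull_size_bounds(2)[OF X(2,3,1)] .
  then have c: "real (card \<F>') = 2 ^ (q * m) + (2 ^ m - real hull_size) * real (card \<F>)"
    by (simp add: F'(2) of_nat_diff)
  have "real (card \<F>') * real hull_size
     = 2 ^ (q * m) * real hull_size + (2 ^ m - real hull_size) * (real (card \<F>) * real hull_size)"
    by (simp add: c algebra_simps)
  also have "\<dots> = 2 ^ (q * m) * 2 ^ m - (2 ^ m - real hull_size) ^ Suc q"
    unfolding F(2) by (simp add: algebra_simps)
  also have "\<dots> = 2 ^ (Suc q * m) - (2 ^ m - real hull_size) ^ Suc q"
    by (simp add: power_add[symmetric] add.commute)
  finally have "real (card \<F>') * real hull_size = 2 ^ (Suc q * m) - (2 ^ m - real hull_size) ^ Suc q" .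
  moreover have "q * m + m = Suc q * m" by simp
  ultimately show ?case using F'(1) by metis
qed

section \<open>Joining ranked families with sets outside the blocks\<close>

text \<open>Suppose \<open>x \<union> A \<subseteq> y \<union> B\<close>. Within one copy
  \<open>X\<close> the outside sets have equal size, so \<open>A = B\<close>. Between different
  copies the rank grows, so \<open>B\<close> would be strictly smaller than \<open>A\<close>; the
  bound by \<open>k\<close> keeps the truncated subtraction strict.\<close>

lemma packing_number_ge_ranked:
  assumes fam: "ranked_family N \<F> w" and c: "\<And>X x. X \<in> \<F> \<Longrightarrow> x \<in> X \<Longrightarrow> w x = c X"
    and k: "\<And>X. X \<in> \<F> \<Longrightarrow> c X \<le> k" and n: "N \<le> n"
  shows "(\<Sum>X\<in>\<F>. (n - N) choose (k - c X)) \<le> packing_number n"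
proof -
  define R where "R = {N + 1..n}"
  define I where "I = (SIGMA X:\<F>. {A. A \<subseteq> R \<and> card A = k - c X})"
  define J where "J = (\<lambda>(X, A :: nat set). (\<lambda>x. x \<union> A) ` X)"
  have finF: "finite \<F>" using fam by (rule ranked_family_finite)
  have sub: "\<F> \<subseteq> Pow (Pow {1..N})" and copy: "\<forall>X\<in>\<F>. is_copy X"
    and rank: "\<forall>X\<in>\<F>. \<forall>Y\<in>\<F>. \<forall>x\<in>X. \<forall>y\<in>Y. X \<noteq> Y \<longrightarrow> x \<subseteq> y \<longrightarrow> w x < w y"
    using fam unfolding ranked_family_def by - (elim conjE, assumption)+
  have finR: "finite R" by (simp add: R_def)
  have sub_iff: "x \<union> A \<subseteq> y \<union> B \<longleftrightarrow> x \<subseteq> y \<and> A \<subseteq> B"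
    if "x \<subseteq> {1..N}" "A \<subseteq> R" "y \<subseteq> {1..N}" "B \<subseteq> R" for x y A B
  proof -
    have "{1..N} \<inter> R = {}" by (auto simp: R_def)
    then show ?thesis using that by blast
  qed
  have no_sub: False
    if h: "X \<in> \<F>" "A \<subseteq> R" "card A = k - c X" "Y \<in> \<F>" "B \<subseteq> R" "card B = k - c Y"
      "(X, A) \<noteq> (Y, B)" "x \<in> X" "y \<in> Y" "x \<union> A \<subseteq> y \<union> B" for X Y A B x y
  proof -
    have "x \<subseteq> {1..N}" "y \<subseteq> {1..N}" using sub h(1,4,8,9) by blast+
    then have s: "x \<subseteq> y" "A \<subseteq> B" using sub_iff h(2,5,10) by simp_all
    have cc: "card A \<le> card B" using s(2) finR h(5) by (meson card_mono finite_subset)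
    show False
    proof (cases "X = Y")
      case True
      then have "card A = card B" using h by simp
      then have "A = B" using s(2) finR h(5) by (meson card_subset_eq finite_subset)
      then show False using True h by simp
    next
      case False
      then have "w x < w y" using rank[rule_format, OF h(1,4,8,9)] s(1) by blast
      then have "c X < c Y" using c h by simp
      then show False using cc h(3,6) k[OF h(4)] by linarith
    qed
  qed
  have inc: "incomparable (J p) (J p')" if "p \<in> I" "p' \<in> I" "p \<noteq> p'" for p p'
  proof -
    obtain X A Y B where p: "p = (X, A)" "p' = (Y, B)" by (cases p, cases p')
    have h: "X \<in> \<F>" "A \<subseteq> R" "card A = k - c X" "Y \<in> \<F>" "B \<subseteq> R" "card B = k - c Y"
      using that p by (auto simp: I_def)
    show ?thesis unfolding incomparable_def
    proof (intro notI, elim bexE)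
      fix a b assume ab: "a \<in> J p" "b \<in> J p'" "a \<subseteq> b \<or> b \<subseteq> a"
      then obtain x y where xy: "x \<in> X" "a = x \<union> A" "y \<in> Y" "b = y \<union> B" using p by (auto simp: J_def)
      have ne: "(X, A) \<noteq> (Y, B)" "(Y, B) \<noteq> (X, A)" using p that(3) by blast+
      show False
        using ab(3) no_sub[OF h(1-6) ne(1) xy(1,3)] no_sub[OF h(4-6) h(1-3) ne(2) xy(3,1)]
        unfolding xy(2,4) by blast
    qed
  qed
  have ne: "J p \<noteq> {}" if "p \<in> I" for p
    using that is_copy_nonempty copy by (auto simp: I_def J_def)
  have "inj_on J I"
  proof (rule inj_onI, rule ccontr)
    fix p p' assume h: "p \<in> I" "p' \<in> I" "J p = J p'" "p \<noteq> p'"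
    \<comment> \<open>A nonempty family is never incomparable with itself.\<close>
    then have "incomparable (J p) (J p)" using inc by metis
    then show False using ne[OF h(1)] unfolding incomparable_def by blast
  qed
  then have "card (J ` I) = card I" by (rule card_image)
  also have "\<dots> = (\<Sum>X\<in>\<F>. card {A. A \<subseteq> R \<and> card A = k - c X})"
    unfolding I_def using finF finR by (intro card_SigmaI) (auto intro: finite_subset[of _ "Pow R"])
  also have "\<dots> = (\<Sum>X\<in>\<F>. (n - N) choose (k - c X))"
    using finR by (simp add: n_subsets R_def)
  finally have "card (J ` I) = (\<Sum>X\<in>\<F>. (n - N) choose (k - c X))" .
  moreover have "card (J ` I) \<le> packing_number n"
  proof (rule packing_number_ge_card)
    show "finite (J ` I)"
      unfolding I_def using finF finR
      by (intro finite_imageI finite_SigmaI) (auto intro: finite_subset[of _ "Pow R"])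
    fix Z assume "Z \<in> J ` I"
    then obtain X A where Z: "X \<in> \<F>" "A \<subseteq> R" "Z = (\<lambda>x. x \<union> A) ` X" by (auto simp: I_def J_def)
    have X: "x \<subseteq> {1..N}" if "x \<in> X" for x using that sub Z(1) by blast
    show "is_copy Z" unfolding Z(3)
      by (rule is_copy_image[OF copy[rule_format, OF Z(1)]]) (simp only: sub_iff[OF X Z(2) X Z(2)] subset_refl simp_thms)
    have "{1..N} \<union> R = {1..n}" using n by (auto simp: R_def)
    then show "Z \<subseteq> Pow {1..n}" using Z X by blast
  next
    fix Z Z' assume "Z \<in> J ` I" "Z' \<in> J ` I" "Z \<noteq> Z'"
    then show "incomparable Z Z'" using inc by blast
  qed
  ultimately show ?thesis by simp
qed

text \<open>Each of the finitely many members contributes asymptotically a fraction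
  \<open>1 / 2 ^ N\<close> of the middle coefficient, whatever its rank.\<close>

lemma packing_number_lower_limit:
  assumes fam: "ranked_family N \<F> w" and a: "a < real (card \<F>) / 2 ^ N"
  shows "eventually (\<lambda>n. a < real (packing_number n) / real (n choose (n div 2))) sequentially"
proof -
  \<comment> \<open>The rank is constant on a copy, so the chosen point does not matter.\<close>
  define c where "c X = w (SOME x. x \<in> X)" for X
  have c: "w x = c X" if "X \<in> \<F>" "x \<in> X" for X x
  proof -
    have "(SOME x. x \<in> X) \<in> X" using that(2) by (rule someI)
    moreover have "\<forall>X\<in>\<F>. \<forall>x\<in>X. \<forall>y\<in>X. w x = w y"
      using fam unfolding ranked_family_def by - (elim conjE, assumption)
    ultimately show ?thesis unfolding c_def using that by blast
  qed
  have finF: "finite \<F>" using fam by (rule ranked_family_finite)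
  have "(\<lambda>n. \<Sum>X\<in>\<F>. real ((n - N) choose (n div 2 - c X)) / real (n choose (n div 2)))
      \<longlonglongrightarrow> (\<Sum>X\<in>\<F>. 1 / 2 ^ N)"
    by (intro tendsto_sum choose_drop_limit)
  moreover have "(\<Sum>X\<in>\<F>. 1 / 2 ^ N) = real (card \<F>) / 2 ^ N" by simp
  ultimately have lim: "(\<lambda>n. \<Sum>X\<in>\<F>. real ((n - N) choose (n div 2 - c X)) / real (n choose (n div 2)))
      \<longlonglongrightarrow> real (card \<F>) / 2 ^ N" by (simp only:)
  have ev: "eventually (\<lambda>n. a < (\<Sum>X\<in>\<F>. real ((n - N) choose (n div 2 - c X)) / real (n choose (n div 2)))) sequentially"
    by (rule order_tendstoD(1)[OF lim a])
  show ?thesis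
    \<comment> \<open>From here on every rank is at most \<open>n div 2\<close>.\<close>
    using ev eventually_ge_at_top[of "N + 2 * (\<Sum>X\<in>\<F>. c X)"]
  proof eventually_elim
    case (elim n)
    have "c X \<le> n div 2" if "X \<in> \<F>" for X
    proof -
      have "c X \<le> (\<Sum>X\<in>\<F>. c X)" using finF that by (intro member_le_sum) auto
      then show ?thesis using elim(2) by linarith
    qed
    then have "(\<Sum>X\<in>\<F>. (n - N) choose (n div 2 - c X)) \<le> packing_number n"
      using elim(2) by (intro packing_number_ge_ranked[OF fam c]) auto
    then have "real (\<Sum>X\<in>\<F>. (n - N) choose (n div 2 - c X)) / real (n choose (n div 2))
        \<le> real (packing_number n) / real (n choose (n div 2))"
      by (intro divide_right_mono of_nat_mono) auto
    then show ?case using elim(1) by (simp add: sum_divide_distrib)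
  qed
qed

section \<open>The limit for an abstract kind of copy\<close>

theorem packing_number_limit:
  "(\<lambda>n. real (packing_number n) / real (n choose (n div 2))) \<longlonglongrightarrow> 1 / real hull_size"
proof (rule order_tendstoI)
  obtain m X where X: "is_copy X" "X \<subseteq> Pow {1..m}" "card (order_hull X) = hull_size"
    using optimal_copy by metis
  define s where "s = real hull_size"
  have s_pos: "0 < s" using hull_size_bounds(1)[OF X(2,3,1)] by (simp add: s_def)
  have "real hull_size \<le> real (2 ^ m)" using hull_size_bounds(2)[OF X(2,3,1)] by (rule of_nat_mono)
  then have "s \<le> 2 ^ m" by (simp add: s_def)
  note s = s_pos this
  {
    fix a assume a: "a < 1 / real hull_size"
    \<comment> \<open>\<open>r\<close> is the proportion of a block outside the optimal hull. The
      number \<open>q\<close> of blocks is fixed in terms of \<open>a\<close> before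
      \<open>n\<close> grows.\<close>
    define r where "r = (2 ^ m - s) / 2 ^ m"
    have r: "0 \<le> r" "r < 1" using s by (auto simp: r_def field_simps)
    have "(\<lambda>q. (1 - r ^ q) / s) \<longlonglongrightarrow> (1 - 0) / s"
      by (intro tendsto_intros LIMSEQ_realpow_zero r) (use s in auto)
    then have "eventually (\<lambda>q. a < (1 - r ^ q) / s) sequentially"
      using a by (intro order_tendstoD(1)) (auto simp: s_def)
    then obtain q where q: "a < (1 - r ^ q) / s" by (auto simp: eventually_sequentially)
    obtain \<F> w where F: "ranked_family (q * m) \<F> w" "real (card \<F>) * s = 2 ^ (q * m) - (2 ^ m - s) ^ q"
      using ranked_family_exists[OF X, of q] unfolding s_def by blast
    have "(1 - r ^ q) / s = real (card \<F>) / 2 ^ (q * m)"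
    proof -
      have "r ^ q = (2 ^ m - s) ^ q / 2 ^ (q * m)"
        unfolding r_def power_divide power_mult[symmetric] by (simp only: mult.commute)
      then have "1 - r ^ q = (real (card \<F>) * s) / 2 ^ (q * m)"
        unfolding F(2) by (simp add: diff_divide_distrib)
      then show ?thesis using s(1) by simp
    qed
    then show "eventually (\<lambda>n. a < real (packing_number n) / real (n choose (n div 2))) sequentially"
      using packing_number_lower_limit[OF F(1)] q by simp
  next
    fix a assume a: "1 / real hull_size < a"
    \<comment> \<open>The upper bound tends to \<open>1 / s\<close> as \<open>K\<close> grows, so
      some fixed \<open>K\<close> brings it below \<open>a\<close>; it then applies to all large
      \<open>n\<close>.\<close>
    have lim: "(\<lambda>K. s * (1 - s / real K)) \<longlonglongrightarrow> s * (1 - 0)"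
      by (intro tendsto_intros lim_const_over_n)
    then have "(\<lambda>K. 1 / (s * (1 - s / real K))) \<longlonglongrightarrow> 1 / (s * (1 - 0))"
      using s(1) by (intro tendsto_divide tendsto_const) auto
    then have "eventually (\<lambda>K. 1 / (s * (1 - s / real K)) < a) sequentially"
      using a by (intro order_tendstoD(2)) (auto simp: s_def)
    moreover have "eventually (\<lambda>K. 0 < s * (1 - s / real K)) sequentially"
      using lim s(1) by (intro order_tendstoD(1)) auto
    ultimately have "eventually (\<lambda>K. 1 / (s * (1 - s / real K)) < a \<and> 0 < s * (1 - s / real K) \<and> 0 < K) sequentially"
      using eventually_gt_at_top[of 0] by eventually_elim auto
    then obtain K where K: "1 / (s * (1 - s / real K)) < a" "0 < s * (1 - s / real K)" "0 < K"
      by (auto simp: eventually_sequentially)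
    show "eventually (\<lambda>n. real (packing_number n) / real (n choose (n div 2)) < a) sequentially"
      using eventually_ge_at_top[of "2 * K + 2 + (hull_size * (K + 1) + K)"]
    proof eventually_elim
      case (elim n)
      have "real (packing_number n) / real (n choose (n div 2)) * (s * (1 - s / real K)) \<le> 1"
        unfolding s_def using elim by (intro packing_number_upper[OF K(3)]) linarith+
      then have "real (packing_number n) / real (n choose (n div 2)) \<le> 1 / (s * (1 - s / real K))"
        using K(2) by (subst pos_le_divide_eq) 
      then show ?case using K(1) by linarith
    qed
  }
qed

end

section \<open>The two kinds of embeddings\<close>

text \<open>Send each element to its principal down-set, with the elements of \<open>P\<close>
  labelled by \<open>{1..card P}\<close>.\<close>

lemma induced_embedding_exists:
  assumes "finite_poset P lt" "P \<noteq> {}"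
  shows "\<exists>n\<ge>1. \<exists>f. induced_embedding P lt n f"
proof -
  have fin: "finite P" and irr: "\<And>a. a \<in> P \<Longrightarrow> \<not> lt a a"
    and trans: "\<And>a b c. a \<in> P \<Longrightarrow> b \<in> P \<Longrightarrow> c \<in> P \<Longrightarrow> lt a b \<Longrightarrow> lt b c \<Longrightarrow> lt a c"
    using assms(1) unfolding finite_poset_def irreflp_on_def transp_on_def by blast+
  obtain h where h: "bij_betw h P {1..card P}" using fin
    by (metis ex_bij_betw_nat_finite_1 bij_betw_inv)
  have inj: "inj_on h P" using h by (rule bij_betw_imp_inj_on)
  define down where "down a = {b\<in>P. b = a \<or> lt b a}" for a
  define f where "f a = h ` down a" for a
  have down_sub: "down a \<subseteq> P" for a by (auto simp: down_def)
  have le: "f a \<subseteq> f b \<longleftrightarrow> a = b \<or> lt a b" if ab: "a \<in> P" "b \<in> P" for a b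
  proof -
    have "h x \<in> h ` down b \<longleftrightarrow> x \<in> down b" if "x \<in> down a" for x
      using that down_sub by (intro inj_on_image_mem_iff[OF inj]) auto
    then have "f a \<subseteq> f b \<longleftrightarrow> down a \<subseteq> down b"
      by (simp add: f_def image_subset_iff subset_eq)
    also have "\<dots> \<longleftrightarrow> a = b \<or> lt a b"
    proof
      assume "down a \<subseteq> down b"
      moreover have "a \<in> down a" using ab by (simp add: down_def)
      ultimately show "a = b \<or> lt a b" by (auto simp: down_def)
    next
      assume "a = b \<or> lt a b"
      then show "down a \<subseteq> down b" unfolding down_def using ab trans by blast
    qed
    finally show ?thesis .
  qed
  have anti: "\<not> (lt a b \<and> lt b a)" if "a \<in> P" "b \<in> P" for a b using that irr trans by blast
  have "induced_embedding P lt (card P) f"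
    unfolding induced_embedding_def
  proof (intro conjI ballI)
    have "f a \<subseteq> {1..card P}" for a
      unfolding f_def using image_mono[OF down_sub, of h] h by (simp add: bij_betw_def)
    then show "f ` P \<subseteq> boolean_lattice (card P)" by (auto simp: boolean_lattice_def)
    show "inj_on f P"
    proof (rule inj_onI)
      fix a b assume ab: "a \<in> P" "b \<in> P" "f a = f b"
      then show "a = b" using le[of a b] le[of b a] anti[of a b] by auto
    qed
    fix a b assume ab: "a \<in> P" "b \<in> P"
    show "f a \<subset> f b \<longleftrightarrow> lt a b"
      using le[OF ab] le[OF ab(2,1)] anti[OF ab] irr[OF ab(1)] by (auto simp: less_le_not_le)
  qed
  moreover have "card P \<ge> 1" using fin assms(2) by (simp add: Suc_le_eq card_gt_0_iff)
  ultimately show ?thesis by blast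
qed

theorem theorem1:
  fixes P :: "'a set" and lt :: "'a \<Rightarrow> 'a \<Rightarrow> bool"
  assumes "finite_poset P lt" and "P \<noteq> {}"
  shows "((\<lambda>n. real (M1 P lt n) / real (n choose (n div 2))) \<longlonglongrightarrow> 1 / real (t1 P lt)) \<and>
         ((\<lambda>n. real (M2 P lt n) / real (n choose (n div 2))) \<longlonglongrightarrow> 1 / real (t2 P lt))"
proof
  obtain n0 f0 where ex: "n0 \<ge> 1" "induced_embedding P lt n0 f0"
    using induced_embedding_exists[OF assms] by blast
  \<comment> \<open>The condition on the codomain is split off, since \<open>E\<close> may depend
    only on inclusions between values.\<close>
  define E1 where "E1 f \<longleftrightarrow> inj_on f P \<and> (\<forall>a\<in>P. \<forall>b\<in>P. lt a b \<longrightarrow> f a \<subset> f b)" for f :: "'a \<Rightarrow> nat set"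
  define E2 where "E2 f \<longleftrightarrow> inj_on f P \<and> (\<forall>a\<in>P. \<forall>b\<in>P. f a \<subset> f b \<longleftrightarrow> lt a b)" for f :: "'a \<Rightarrow> nat set"
  have emb1: "embedding P lt n f \<longleftrightarrow> E1 f \<and> f ` P \<subseteq> Pow {1..n}" for n f
    by (auto simp: embedding_def E1_def boolean_lattice_def)
  have emb2: "induced_embedding P lt n f \<longleftrightarrow> E2 f \<and> f ` P \<subseteq> Pow {1..n}" for n f
    unfolding induced_embedding_def E2_def boolean_lattice_def by blast
  have inj: "inj_on g P" if "inj_on f P" "\<And>a b. a \<in> P \<Longrightarrow> b \<in> P \<Longrightarrow> f a \<subseteq> f b \<longleftrightarrow> g a \<subseteq> g b"
    for f g :: "'a \<Rightarrow> nat set"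
  proof (rule inj_onI)
    fix a b assume ab: "a \<in> P" "b \<in> P" "g a = g b"
    have "f a = f b" using that(2)[OF ab(1,2)] that(2)[OF ab(2,1)] ab(3) by (simp add: subset_antisym)
    then show "a = b" using inj_onD[OF that(1)] ab(1,2) by blast
  qed
  interpret c1: copies P E1
  proof
    show "E1 g" if "E1 f" "\<And>a b. a \<in> P \<Longrightarrow> b \<in> P \<Longrightarrow> f a \<subseteq> f b \<longleftrightarrow> g a \<subseteq> g b" for f g
      using that inj[of f g] unfolding E1_def less_le_not_le by simp
    \<comment> \<open>An induced embedding is in particular an embedding.\<close>
    have "E1 f0" using ex(2) unfolding induced_embedding_def E1_def by blast
    then show "\<exists>n\<ge>1. \<exists>f. E1 f \<and> f ` P \<subseteq> Pow {1..n}" using ex emb2 by blast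
  qed (rule assms(2))
  interpret c2: copies P E2
  proof
    show "E2 g" if "E2 f" "\<And>a b. a \<in> P \<Longrightarrow> b \<in> P \<Longrightarrow> f a \<subseteq> f b \<longleftrightarrow> g a \<subseteq> g b" for f g
      using that inj[of f g] unfolding E2_def less_le_not_le by simp
    show "\<exists>n\<ge>1. \<exists>f. E2 f \<and> f ` P \<subseteq> Pow {1..n}" using ex emb2 by blast
  qed (rule assms(2))
  have "t1 P lt = c1.hull_size"
    unfolding t1_def c1.hull_size_def emb1
    by (simp add: conv_eq_hull cong: conj_cong)
  moreover have "M1 P lt n = c1.packing_number n" for n
    unfolding M1_def c1.packing_number_def c1.packing_def[abs_def] emb1 by (rule refl)
  ultimately show "(\<lambda>n. real (M1 P lt n) / real (n choose (n div 2))) \<longlonglongrightarrow> 1 / real (t1 P lt)"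
    using c1.packing_number_limit by simp
  have "t2 P lt = c2.hull_size"
    unfolding t2_def c2.hull_size_def emb2
    by (simp add: conv_eq_hull cong: conj_cong)
  moreover have "M2 P lt n = c2.packing_number n" for n
    unfolding M2_def c2.packing_number_def c2.packing_def[abs_def] emb2 by (rule refl)
  ultimately show "(\<lambda>n. real (M2 P lt n) / real (n choose (n div 2))) \<longlonglongrightarrow> 1 / real (t2 P lt)"
    using c2.packing_number_limit by simp
qed

end
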